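(* Let $\omega\in\mathbb{C}$, $\omega\ne0$, and $n\ge1$. The $n$-fold braided tensor product algebra $BU_q(h)^{\underline\otimes n}$ and the $n$-fold ordinary tensor product algebra $U_q(h)^{\otimes n}$ are isomorphic as algebras.
   Context: Convention on exponentials: central elements $H_i$ (resp. $\bar H_i$) come together with central invertible elements $e^{\omega H_i/4}$ (resp. $e^{\omega\bar H_i/4}$); other exponentials are products of integer powers of these. $[H]=\frac1\omega(e^{\omega H/2}-e^{-\omega H/2})$. **$U_q(h)^{\otimes n}$**: unital algebra generated by $A_i,A_i^\dagger,N_i,H_i$ and $e^{\pm\omega H_i/4}$ ($1\le i\le n$) with $H_i$, $e^{\pm\omega H_i/4}$ central and $[A_i,A_j]=0=[A_i^\dagger,A_j^\dagger]$, $[A_i,A_j^\dagger]=\delta_{ij}[H_i]$, $[N_i,A_j]=-\delta_{ij}A_i$, $[N_i,A_j^\dagger]=\delta_{ij}A_i^\dagger$, $[N_i,N_j]=0$. **$BU_q(h)^{\underline\otimes n}$**: the $n$-fold braided tensor product, in which the product of two tensor factors is $(a\otimes b)(c\otimes d)=a\Psi(b\otimes c)d$, where $\Psi$ is the braiding of $BU_q(h)$ (which has the same algebra as $U_q(h)$). Explicitly it is the unital algebra generated by $\bar A_i,\bar A_i^\dagger,\bar N_i,\bar H_i$, $e^{\pm\omega\bar H_i/4}$ ($\bar Y_i$ being the element with $Y$ in the $i$-th place and $1$ elsewhere), with $\bar H_i$, $e^{\pm\omega\bar H_i/4}$ central and - $[\bar A_i,\bar A_j]=0$, $[\bar A_i^\dagger,\bar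 A_j^\dagger]=0$ for all $i,j$; - $[\bar A_i,\bar A_j^\dagger]=\omega e^{-\omega\bar H_i/4}[\bar H_i]e^{-\omega\bar H_j/4}[\bar H_j]$ if $i<j$; $=[\bar H_i]$ if $i=j$; $=0$ if $i>j$; - $[\bar N_i,\bar A_j]=0$ if $i<j$; $=-\bar A_i$ if $i=j$; $=-\omega e^{-\omega\bar H_j/4}[\bar H_j]e^{-\omega\bar H_i/4}\bar A_i$ if $i>j$; - $[\bar N_i,\bar A_j^\dagger]=\omega e^{-\omega\bar H_i/4}\bar A_i^\dagger e^{-\omega\bar H_j/4}[\bar H_j]$ if $i<j$; $=\bar A_i^\dagger$ if $i=j$; $=0$ if $i>j$; - $[\bar N_i,\bar N_j]=\omega e^{-\omega\bar H_i/4}\bar A_i^\dagger e^{-\omega\bar H_j/4}\bar A_j$ if $i<j$. *)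

theory Defs
  imports Complex_Main "HOL-Library.Poly_Mapping" "HOL-Algebra.QuotRing" "HOL-Algebra.Module"
begin

section \<open>Free unital complex algebras\<close>

text \<open>Words form the free monoid, written additively because \<^theory>\<open>HOL-Library.Poly_Mapping\<close>
  convolves over an additive (here non-commutative) monoid of exponents.\<close>

datatype 'g word = Word (letters: "'g list")

instantiation word :: (type) monoid_add
begin

definition zero_word :: "'a word" where
  "zero_word = Word []"

definition plus_word :: "'a word \<Rightarrow> 'a word \<Rightarrow> 'a word" where
  "plus_word u v = Word (letters u @ letters v)"

instance
  by standard (simp_all add: zero_word_def plus_word_def)

end

text \<open>Non-commutative polynomials; the product from the class \<^class>\<open>ring_1\<close> is
  the bilinear extension of concatenation of words.\<close>

type_synonym 'g ncpoly = "'g word \<Rightarrow>\<^sub>0 complex"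

definition scal :: "complex \<Rightarrow> 'g ncpoly" where
  "scal c = Poly_Mapping.single 0 c"

definition gen :: "'g \<Rightarrow> 'g ncpoly" where
  "gen x = Poly_Mapping.single (Word [x]) 1"

definition commutator :: "'a::ring \<Rightarrow> 'a \<Rightarrow> 'a" where
  "commutator a b = a * b - b * a"

text \<open>A complex algebra is recorded as a \<^const>\<open>module_ext\<close> record, i.e. a (non-commutative) ring
  with a scalar multiplication.\<close>

definition free_algebra :: "'g set \<Rightarrow> (complex, 'g ncpoly) module" where
  "free_algebra X =
    \<lparr>carrier = {p. \<forall>w\<in>Poly_Mapping.keys p. set (letters w) \<subseteq> X},
     mult = (*), one = 1, zero = 0, add = (+), smult = (\<lambda>c p. scal c * p)\<rparr>"

text \<open>The quotient of an algebra by a two-sided ideal, with the induced scalar multiplication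
  on cosets (compare \<^const>\<open>rcoset_mult\<close>).\<close>

definition quot_algebra :: "('k, 'a) module \<Rightarrow> 'a set \<Rightarrow> ('k, 'a set) module" where
  "quot_algebra F I =
    \<lparr>carrier = carrier (F Quot I), mult = mult (F Quot I), one = one (F Quot I),
     zero = zero (F Quot I), add = add (F Quot I),
     smult = (\<lambda>c C. \<Union>p\<in>C. I +>\<^bsub>F\<^esub> (c \<odot>\<^bsub>F\<^esub> p))\<rparr>"

text \<open>Generators \<open>X\<close>, and relations \<open>r = 0\<close> for \<open>r \<in> R\<close>.\<close>

definition presented_algebra :: "'g set \<Rightarrow> 'g ncpoly set \<Rightarrow> (complex, 'g ncpoly set) module" where
  "presented_algebra X R = quot_algebra (free_algebra X) (Idl\<^bsub>free_algebra X\<^esub> R)"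

definition algebra_iso :: "('k, 'a) module \<Rightarrow> ('k, 'b) module \<Rightarrow> ('a \<Rightarrow> 'b) set" where
  "algebra_iso S T =
    {h \<in> ring_iso S T. \<forall>c. \<forall>x\<in>carrier S. h (c \<odot>\<^bsub>S\<^esub> x) = c \<odot>\<^bsub>T\<^esub> h x}"

definition algebras_isomorphic :: "('k, 'a) module \<Rightarrow> ('k, 'b) module \<Rightarrow> bool" where
  "algebras_isomorphic S T \<longleftrightarrow> algebra_iso S T \<noteq> {}"


section \<open>The two algebras\<close>

text \<open>\<open>Exp i\<close> and \<open>ExpInv i\<close> stand for $e^{\omega H_i/4}$ and $e^{-\omega H_i/4}$. As elements of
  the algebra these are independent of \<open>H i\<close>: the defining relations only say that they
  are central and mutually inverse.\<close>

datatype heis_gen =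
    Ann nat \<comment> \<open>$A_i$\<close>
  | Cre nat \<comment> \<open>$A_i^\dagger$\<close>
  | Num nat \<comment> \<open>$N_i$\<close>
  | Cen nat \<comment> \<open>$H_i$\<close>
  | Exp nat
  | ExpInv nat

definition heis_gens :: "nat \<Rightarrow> heis_gen set" where
  "heis_gens n =
    (\<Union>i\<in>{1..n}. {Ann i, Cre i, Num i, Cen i, Exp i, ExpInv i})"

abbreviation gA :: "nat \<Rightarrow> heis_gen ncpoly" where "gA i \<equiv> gen (Ann i)"
abbreviation gAd :: "nat \<Rightarrow> heis_gen ncpoly" where "gAd i \<equiv> gen (Cre i)"
abbreviation gN :: "nat \<Rightarrow> heis_gen ncpoly" where "gN i \<equiv> gen (Num i)"
abbreviation gH :: "nat \<Rightarrow> heis_gen ncpoly" where "gH i \<equiv> gen (Cen i)"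
abbreviation gE :: "nat \<Rightarrow> heis_gen ncpoly" where "gE i \<equiv> gen (Exp i)"
abbreviation gE' :: "nat \<Rightarrow> heis_gen ncpoly" where "gE' i \<equiv> gen (ExpInv i)"

text \<open>$[H_i] = \frac1\omega(e^{\omega H_i/2} - e^{-\omega H_i/2})$\<close>

definition brH :: "complex \<Rightarrow> nat \<Rightarrow> heis_gen ncpoly" where
  "brH \<omega> i = scal (1 / \<omega>) * (gE i ^ 2 - gE' i ^ 2)"

definition central_rels :: "nat \<Rightarrow> heis_gen ncpoly set" where
  "central_rels n =
    (\<Union>i\<in>{1..n}. \<Union>x\<in>heis_gens n.
       {commutator (gH i) (gen x), commutator (gE i) (gen x), commutator (gE' i) (gen x)}) \<union>
    (\<Union>i\<in>{1..n}. {gE i * gE' i - 1, gE' i * gE i - 1})"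

definition tensor_rels :: "complex \<Rightarrow> nat \<Rightarrow> heis_gen ncpoly set" where
  "tensor_rels \<omega> n = central_rels n \<union>
    (\<Union>i\<in>{1..n}. \<Union>j\<in>{1..n}.
      {commutator (gA i) (gA j),
       commutator (gAd i) (gAd j),
       commutator (gA i) (gAd j) - (if i = j then brH \<omega> i else 0),
       commutator (gN i) (gA j) - (if i = j then - gA i else 0),
       commutator (gN i) (gAd j) - (if i = j then gAd i else 0),
       commutator (gN i) (gN j)})"

definition braided_rels :: "complex \<Rightarrow> nat \<Rightarrow> heis_gen ncpoly set" where
  "braided_rels \<omega> n = central_rels n \<union>
    (\<Union>i\<in>{1..n}. \<Union>j\<in>{1..n}.
      {commutator (gA i) (gA j),
       commutator (gAd i) (gAd j),
       commutator (gA i) (gAd j) -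
         (if i < j then scal \<omega> * gE' i * brH \<omega> i * gE' j * brH \<omega> j
          else if i = j then brH \<omega> i else 0),
       commutator (gN i) (gA j) -
         (if i < j then 0
          else if i = j then - gA i
          else - (scal \<omega> * gE' j * brH \<omega> j * gE' i * gA i)),
       commutator (gN i) (gAd j) -
         (if i < j then scal \<omega> * gE' i * gAd i * gE' j * brH \<omega> j
          else if i = j then gAd i else 0)}) \<union>
    {commutator (gN i) (gN j) - scal \<omega> * gE' i * gAd i * gE' j * gA j | i j.
       i \<in> {1..n} \<and> j \<in> {1..n} \<and> i < j}"

text \<open>$U_q(h)^{\otimes n}$ and $BU_q(h)^{\underline\otimes n}$ by generators and relations;
  in the latter \<open>Ann i\<close> is read as $\bar A_i$, and so on.\<close>

definition Uq_tensor :: "complex \<Rightarrow> nat \<Rightarrow> (complex, heis_gen ncpoly set) module" where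
  "Uq_tensor \<omega> n = presented_algebra (heis_gens n) (tensor_rels \<omega> n)"

definition BUq_braided_tensor :: "complex \<Rightarrow> nat \<Rightarrow> (complex, heis_gen ncpoly set) module" where
  "BUq_braided_tensor \<omega> n = presented_algebra (heis_gens n) (braided_rels \<omega> n)"


section \<open>Well-formedness\<close>

text \<open>\<^const>\<open>genideal\<close> is only meaningful when the ambient structure is a ring containing the
  given set; this holds for the free algebra and the relations above.\<close>

abbreviation ncpolys :: "'g set \<Rightarrow> 'g ncpoly set" where
  "ncpolys X \<equiv> carrier (free_algebra X)"

lemma carrier_free_algebra:
  "p \<in> ncpolys X \<longleftrightarrow> (\<forall>w\<in>Poly_Mapping.keys p. set (letters w) \<subseteq> X)"
  by (simp add: free_algebra_def)

lemma ncpolys_add [intro]: "p \<in> ncpolys X \<Longrightarrow> q \<in> ncpolys X \<Longrightarrow> p + q \<in> ncpolys X"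
  using Poly_Mapping.keys_add[of p q] by (fastforce simp: carrier_free_algebra)

lemma ncpolys_uminus [intro]: "p \<in> ncpolys X \<Longrightarrow> - p \<in> ncpolys X"
  by (simp add: carrier_free_algebra)

lemma ncpolys_diff [intro]: "p \<in> ncpolys X \<Longrightarrow> q \<in> ncpolys X \<Longrightarrow> p - q \<in> ncpolys X"
  using ncpolys_add[of p X "- q"] by auto

lemma ncpolys_mult [intro]: "p \<in> ncpolys X \<Longrightarrow> q \<in> ncpolys X \<Longrightarrow> p * q \<in> ncpolys X"
  using Poly_Mapping.keys_mult[of p q]
  by (fastforce simp: carrier_free_algebra plus_word_def)

lemma ncpolys_scal [intro]: "scal c \<in> ncpolys X"
  by (simp add: carrier_free_algebra scal_def zero_word_def)

lemma ncpolys_zero [intro]: "0 \<in> ncpolys X"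
  by (simp add: carrier_free_algebra)

lemma ncpolys_one [intro]: "1 \<in> ncpolys X"
  using ncpolys_scal[of 1 X] by (simp add: scal_def)

lemma ncpolys_gen [intro]: "x \<in> X \<Longrightarrow> gen x \<in> ncpolys X"
  by (simp add: carrier_free_algebra gen_def)

lemma free_algebra_ops:
  "mult (free_algebra X) = (*)" "one (free_algebra X) = 1"
  "zero (free_algebra X) = 0" "add (free_algebra X) = (+)"
  by (simp_all add: free_algebra_def)

lemma ring_free_algebra: "ring (free_algebra X)"
proof (intro ringI abelian_groupI monoidI)
  fix p assume "p \<in> ncpolys X"
  then show "\<exists>q\<in>ncpolys X. q \<oplus>\<^bsub>free_algebra X\<^esub> p = \<zero>\<^bsub>free_algebra X\<^esub>"
    by (intro bexI[of _ "- p"]) (auto simp: free_algebra_ops)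
qed (auto simp: free_algebra_ops algebra_simps)

lemma tensor_rels_subset: "tensor_rels \<omega> n \<subseteq> ncpolys (heis_gens n)"
  unfolding tensor_rels_def central_rels_def commutator_def brH_def power2_eq_square
  by (auto split: if_splits
    intro!: ncpolys_diff ncpolys_mult ncpolys_uminus ncpolys_scal ncpolys_zero ncpolys_one
      ncpolys_gen simp: heis_gens_def)

lemma braided_rels_subset: "braided_rels \<omega> n \<subseteq> ncpolys (heis_gens n)"
  unfolding braided_rels_def central_rels_def commutator_def brH_def power2_eq_square
  by (auto split: if_splits
    intro!: ncpolys_diff ncpolys_mult ncpolys_uminus ncpolys_scal ncpolys_zero ncpolys_one
      ncpolys_gen simp: heis_gens_def)

end

theory Submission
  imports Defs
begin

text \<open>Write \<open>k\<^sub>i\<close> for $e^{-\omega H_i/4}$ and \<open>S\<^sub>i = \<Sum>\<^bsub>l>i\<^esub> k\<^sub>l A\<^sub>l\<close>. The substitution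
  \<open>A\<^sub>i \<mapsto> A\<^sub>i + \<omega> k\<^sub>i [H\<^sub>i] S\<^sub>i\<close>, \<open>N\<^sub>i \<mapsto> N\<^sub>i + \<omega> k\<^sub>i A\<^sub>i\<^sup>\<dagger> S\<^sub>i\<close>, fixing the other generators, is
  triangular, hence already an automorphism of the free algebra. Modulo the tensor relations,
  \<open>[S\<^sub>i, A\<^sub>j\<^sup>\<dagger>]\<close> is \<open>k\<^sub>j [H\<^sub>j]\<close> for \<open>i < j\<close> and \<open>0\<close> otherwise, and the new \<open>N\<^sub>i\<close> sends \<open>A\<^sub>j\<close> to
  minus the new \<open>A\<^sub>i\<close> if \<open>i = j\<close> and to \<open>0\<close> otherwise; by the Leibniz rule the new
  generators satisfy the braided relations. Solving for the old generators gives the converse, so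
  the automorphism exchanges the two ideals of relations.\<close>

section \<open>Commutators modulo a two-sided ideal\<close>

locale two_sided_ideal =
  fixes K :: "'a::ring_1 set"
  assumes zero_mem: "0 \<in> K"
    and diff_mem: "x \<in> K \<Longrightarrow> y \<in> K \<Longrightarrow> x - y \<in> K"
    and mult_left_mem: "x \<in> K \<Longrightarrow> a * x \<in> K"
    and mult_right_mem: "x \<in> K \<Longrightarrow> x * a \<in> K"
begin

lemma uminus_mem: "x \<in> K \<Longrightarrow> - x \<in> K"
  using diff_mem[OF zero_mem, of x] by simp

lemma add_mem: "x \<in> K \<Longrightarrow> y \<in> K \<Longrightarrow> x + y \<in> K"
  using diff_mem[OF _ uminus_mem, of x y] by simp

definition eqv :: "'a \<Rightarrow> 'a \<Rightarrow> bool" (infix "\<approx>" 50) where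
  "x \<approx> y \<longleftrightarrow> x - y \<in> K"

lemma eqv_refl [simp, intro]: "x \<approx> x"
  by (simp add: eqv_def zero_mem)

lemma eqv_sym: "x \<approx> y \<Longrightarrow> y \<approx> x"
  using uminus_mem[of "x - y"] by (simp add: eqv_def)

lemma eqv_trans [trans]: "x \<approx> y \<Longrightarrow> y \<approx> z \<Longrightarrow> x \<approx> z"
  using add_mem[of "x - y" "y - z"] by (simp add: eqv_def)

lemma eqv_add: "x \<approx> y \<Longrightarrow> x' \<approx> y' \<Longrightarrow> x + x' \<approx> y + y'"
  using add_mem[of "x - y" "x' - y'"] by (simp add: eqv_def algebra_simps)

lemma eqv_uminus: "x \<approx> y \<Longrightarrow> - x \<approx> - y"
  using uminus_mem[of "x - y"] by (simp add: eqv_def)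

lemma eqv_diff: "x \<approx> y \<Longrightarrow> x' \<approx> y' \<Longrightarrow> x - x' \<approx> y - y'"
  using eqv_add[OF _ eqv_uminus, of x y x' y'] by simp

lemma eqv_mult_left: "x \<approx> y \<Longrightarrow> a * x \<approx> a * y"
  using mult_left_mem[of "x - y" a] by (simp add: eqv_def algebra_simps)

lemma eqv_mult_right: "x \<approx> y \<Longrightarrow> x * a \<approx> y * a"
  using mult_right_mem[of "x - y" a] by (simp add: eqv_def algebra_simps)

lemma mem_iff_eqv_zero: "x \<in> K \<longleftrightarrow> x \<approx> 0"
  by (simp add: eqv_def)

lemma commutator_swap: "commutator x y \<approx> z \<Longrightarrow> commutator y x \<approx> - z"
  using uminus_mem[of "commutator x y - z"] by (simp add: eqv_def commutator_def algebra_simps)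

lemma commutator_add_left:
  "commutator x u \<approx> p \<Longrightarrow> commutator y u \<approx> q \<Longrightarrow> commutator (x + y) u \<approx> p + q"
  using eqv_add[of "commutator x u" p "commutator y u" q]
  by (simp add: commutator_def algebra_simps)

lemma commutator_add_right:
  "commutator u x \<approx> p \<Longrightarrow> commutator u y \<approx> q \<Longrightarrow> commutator u (x + y) \<approx> p + q"
  using eqv_add[of "commutator u x" p "commutator u y" q]
  by (simp add: commutator_def algebra_simps)

lemma commutator_diff_left:
  "commutator x u \<approx> p \<Longrightarrow> commutator y u \<approx> q \<Longrightarrow> commutator (x - y) u \<approx> p - q"
  using eqv_diff[of "commutator x u" p "commutator y u" q]
  by (simp add: commutator_def algebra_simps)

lemma commutator_diff_right:
  "commutator u x \<approx> p \<Longrightarrow> commutator u y \<approx> q \<Longrightarrow> commutator u (x - y) \<approx> p - q"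
  using eqv_diff[of "commutator u x" p "commutator u y" q]
  by (simp add: commutator_def algebra_simps)

lemma commutator_mult_left:
  assumes "commutator x u \<approx> p" "commutator y u \<approx> q"
  shows "commutator (x * y) u \<approx> p * y + x * q"
proof -
  have "commutator (x * y) u = commutator x u * y + x * commutator y u"
    by (simp add: commutator_def algebra_simps)
  then show ?thesis
    using eqv_add[OF eqv_mult_right[OF assms(1)] eqv_mult_left[OF assms(2)]] by simp
qed

lemma commutator_mult_right:
  assumes "commutator u x \<approx> p" "commutator u y \<approx> q"
  shows "commutator u (x * y) \<approx> p * y + x * q"
proof -
  have "commutator u (x * y) = commutator u x * y + x * commutator u y"
    by (simp add: commutator_def algebra_simps)
  then show ?thesis
    using eqv_add[OF eqv_mult_right[OF assms(1)] eqv_mult_left[OF assms(2)]] by simp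
qed

section \<open>Elements that are central modulo the ideal\<close>

definition central :: "'a \<Rightarrow> bool" where
  "central c \<longleftrightarrow> (\<forall>x. commutator c x \<approx> 0)"

lemma central_mult: "central c \<Longrightarrow> central d \<Longrightarrow> central (c * d)"
  using commutator_mult_left[of c _ 0 d 0] by (simp add: central_def)

lemma central_diff: "central c \<Longrightarrow> central d \<Longrightarrow> central (c - d)"
  using commutator_diff_left[of c _ 0 d 0] by (simp add: central_def)

lemma central_commutator: "central c \<Longrightarrow> commutator c x \<approx> 0" "central c \<Longrightarrow> commutator x c \<approx> 0"
  using commutator_swap[of c x 0] by (auto simp: central_def)

lemma commutator_central_mult_left:
  "central c \<Longrightarrow> commutator x u \<approx> p \<Longrightarrow> commutator (c * x) u \<approx> c * p"
  using commutator_mult_left[of c u 0 x p] by (simp add: central_commutator)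

lemma commutator_central_mult_right:
  "central c \<Longrightarrow> commutator u x \<approx> p \<Longrightarrow> commutator u (c * x) \<approx> c * p"
  using commutator_mult_right[of u c 0 x p] by (simp add: central_commutator)

lemma central_move: "central c \<Longrightarrow> x * (c * y) \<approx> c * (x * y)"
  using eqv_mult_right[OF central_commutator(2)[of c x, unfolded commutator_def], of y]
  by (simp add: eqv_def algebra_simps)

lemma eqv_sum: "(\<And>l. l \<in> I \<Longrightarrow> f l \<approx> g l) \<Longrightarrow> sum f I \<approx> sum g I"
  by (induction I rule: infinite_finite_induct) (auto intro: eqv_add)

text \<open>The central weights pass through the commutator, so only the \<open>x l\<close> are
  differentiated, and the Kronecker delta leaves the summand \<open>l = j\<close>. The value
  \<open>z\<close> must not depend on \<open>l\<close>.\<close>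

lemma commutator_weighted_sum:
  assumes "finite I" and "\<And>l. l \<in> I \<Longrightarrow> central (k l)"
    and "\<And>l. l \<in> I \<Longrightarrow> commutator (x l) u \<approx> (if l = j then z else 0)"
  shows "commutator (\<Sum>l\<in>I. k l * x l) u \<approx> (if j \<in> I then k j * z else 0)"
proof -
  have "commutator (\<Sum>l\<in>I. k l * x l) u = (\<Sum>l\<in>I. commutator (k l * x l) u)"
    by (simp add: commutator_def sum_distrib_left sum_distrib_right sum_subtractf)
  also have "\<dots> \<approx> (\<Sum>l\<in>I. if l = j then k j * z else 0)"
  proof (rule eqv_sum)
    fix l assume "l \<in> I"
    then show "commutator (k l * x l) u \<approx> (if l = j then k j * z else 0)"
      using commutator_central_mult_left[OF assms(2)[of l] assms(3)[of l]] by (cases "l = j") auto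
  qed
  finally show ?thesis
    using assms(1) by (simp cong: if_cong)
qed

lemma commutator_weighted_sum_zero:
  assumes "finite I" and "\<And>l. l \<in> I \<Longrightarrow> central (k l)"
    and "\<And>l. l \<in> I \<Longrightarrow> commutator (x l) u \<approx> 0"
  shows "commutator (\<Sum>l\<in>I. k l * x l) u \<approx> 0"
proof -
  \<comment> \<open>With \<open>z = 0\<close> any index can play the part of \<open>j\<close>, so an
    arbitrary one is taken.\<close>
  have "commutator (\<Sum>l\<in>I. k l * x l) u \<approx> (if undefined \<in> I then k undefined * 0 else 0)"
    by (rule commutator_weighted_sum) (use assms in auto)
  then show ?thesis by (simp cong: if_cong)
qed

end

section \<open>The triangular change of generators\<close>

text \<open>Neither \<open>A\<close>, \<open>N\<close> nor \<open>B\<close>, \<open>M\<close> is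
  declared to be the generators, so the locale serves both directions: first \<open>A\<close>,
  \<open>N\<close> are generators and \<open>B\<close>, \<open>M\<close> their images, then
  \<open>B\<close>, \<open>M\<close> are generators and \<open>A\<close>, \<open>N\<close> the
  images under the inverse substitution.\<close>

locale triangular_change = two_sided_ideal +
  fixes n :: nat and w :: 'a and k h A Ad N B M S :: "nat \<Rightarrow> 'a"
  assumes central_w: "central w"
    and central_k: "i \<in> {1..n} \<Longrightarrow> central (k i)"
    and central_h: "i \<in> {1..n} \<Longrightarrow> central (h i)"
    and S_eq: "S i = (\<Sum>l\<in>{i<..n}. k l * A l)"
    and B_eq: "B i = A i + w * k i * h i * S i"
    and M_eq: "M i = N i + w * k i * Ad i * S i"
begin

lemma central_coeff: "i \<in> {1..n} \<Longrightarrow> central (w * k i)" "i \<in> {1..n} \<Longrightarrow> central (w * k i * h i)"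
  by (auto intro!: central_mult central_w central_k central_h)

lemma commutator_S:
  assumes "i \<in> {1..n}" "j \<in> {1..n}"
    and "\<And>l. l \<in> {i<..n} \<Longrightarrow> commutator (A l) u \<approx> (if l = j then z else 0)"
  shows "commutator (S i) u \<approx> (if i < j then k j * z else 0)"
proof -
  have "commutator (S i) u \<approx> (if j \<in> {i<..n} then k j * z else 0)"
    unfolding S_eq by (rule commutator_weighted_sum) (use assms central_k in auto)
  then show ?thesis using assms(2) by auto
qed

lemma commutator_S_zero:
  assumes "i \<in> {1..n}"
    and "\<And>l. l \<in> {i<..n} \<Longrightarrow> commutator (A l) u \<approx> 0"
  shows "commutator (S i) u \<approx> 0"
  unfolding S_eq by (rule commutator_weighted_sum_zero) (use assms central_k in auto)

definition tensor_relations :: bool where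
  "tensor_relations \<longleftrightarrow> (\<forall>i\<in>{1..n}. \<forall>j\<in>{1..n}.
     commutator (A i) (A j) \<approx> 0 \<and>
     commutator (Ad i) (Ad j) \<approx> 0 \<and>
     commutator (A i) (Ad j) \<approx> (if i = j then h i else 0) \<and>
     commutator (N i) (A j) \<approx> (if i = j then - A i else 0) \<and>
     commutator (N i) (Ad j) \<approx> (if i = j then Ad i else 0) \<and>
     commutator (N i) (N j) \<approx> 0)"

definition braided_relations :: bool where
  "braided_relations \<longleftrightarrow> (\<forall>i\<in>{1..n}. \<forall>j\<in>{1..n}.
     commutator (B i) (B j) \<approx> 0 \<and>
     commutator (Ad i) (Ad j) \<approx> 0 \<and>
     commutator (B i) (Ad j) \<approx>
       (if i < j then w * k i * h i * k j * h j else if i = j then h i else 0) \<and>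
     commutator (M i) (B j) \<approx>
       (if i < j then 0 else if i = j then - B i else - (w * k j * h j * k i * B i)) \<and>
     commutator (M i) (Ad j) \<approx>
       (if i < j then w * k i * Ad i * k j * h j else if i = j then Ad i else 0) \<and>
     (i < j \<longrightarrow> commutator (M i) (M j) \<approx> w * k i * Ad i * k j * B j))"

text \<open>Commutators with the tails \<open>S i\<close> come first. Every braided relation then
  follows by applying the Leibniz rule to the correction terms of \<open>B\<close> and
  \<open>M\<close>, since a commutator with \<open>S i\<close> sees the index \<open>j\<close>
  exactly when \<open>i < j\<close>.\<close>

lemma braided_if_tensor:
  assumes tensor_relations
  shows braided_relations
proof -
  have AA: "commutator (A i) (A j) \<approx> 0"
    and DD: "commutator (Ad i) (Ad j) \<approx> 0"
    \<comment> \<open>The diagonal value is written \<open>h j\<close> rather than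
      \<open>h i\<close>, because \<open>commutator_S\<close> sums over the first index and requires
      a value independent of it.\<close>
    and AD: "commutator (A i) (Ad j) \<approx> (if i = j then h j else 0)"
    and NA: "commutator (N i) (A j) \<approx> (if j = i then - A i else 0)"
    and ND: "commutator (N i) (Ad j) \<approx> (if i = j then Ad i else 0)"
    and NN: "commutator (N i) (N j) \<approx> 0"
    and AN: "commutator (A j) (N i) \<approx> (if j = i then A i else 0)"
    if "i \<in> {1..n}" "j \<in> {1..n}" for i j
    using assms[unfolded tensor_relations_def, rule_format, OF that]
      commutator_swap[of "N i" "A j" "if i = j then - A i else 0"]
    by (auto split: if_splits)
  have DA: "commutator (Ad i) (A j) \<approx> (if j = i then - h i else 0)"
    if "i \<in> {1..n}" "j \<in> {1..n}" for i j
    using commutator_swap[OF AD[OF that(2,1)]] by (auto split: if_splits)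
  have SA: "commutator (S i) (A j) \<approx> 0" if "i \<in> {1..n}" "j \<in> {1..n}" for i j
    by (rule commutator_S_zero) (use that AA in auto)
  have AS: "commutator (A i) (S j) \<approx> 0" if "i \<in> {1..n}" "j \<in> {1..n}" for i j
    using commutator_swap[OF SA[OF that(2,1)]] by simp
  have SS: "commutator (S i) (S j) \<approx> 0" if "i \<in> {1..n}" "j \<in> {1..n}" for i j
    by (rule commutator_S_zero) (use that AS in auto)
  have SD: "commutator (S i) (Ad j) \<approx> (if i < j then k j * h j else 0)"
    if "i \<in> {1..n}" "j \<in> {1..n}" for i j
    by (rule commutator_S) (use that AD in auto)
  have SN: "commutator (S i) (N j) \<approx> (if i < j then k j * A j else 0)"
    if "i \<in> {1..n}" "j \<in> {1..n}" for i j
    by (rule commutator_S) (use that AN in auto)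
  have SB: "commutator (S i) (B j) \<approx> 0" if "i \<in> {1..n}" "j \<in> {1..n}" for i j
    using commutator_add_right[OF SA[of i j] commutator_central_mult_right[OF central_coeff(2)[of j] SS[of i j]]]
      that by (simp add: B_eq)
  have BB: "commutator (B i) (B j) \<approx> 0" if "i \<in> {1..n}" "j \<in> {1..n}" for i j
  proof -
    have "commutator (A i) (B j) \<approx> 0"
      using commutator_add_right[OF AA[of i j] commutator_central_mult_right[OF central_coeff(2)[of j] AS[of i j]]]
        that by (simp add: B_eq)
    from commutator_add_left[OF this commutator_central_mult_left[OF central_coeff(2)[of i] SB[of i j]]]
    show ?thesis using that by (simp add: B_eq)
  qed
  have BD: "commutator (B i) (Ad j) \<approx>
      (if i < j then w * k i * h i * k j * h j else if i = j then h i else 0)"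
    if "i \<in> {1..n}" "j \<in> {1..n}" for i j
    using commutator_add_left[OF AD[of i j] commutator_central_mult_left[OF central_coeff(2)[of i] SD[of i j]]]
      that by (auto simp: B_eq mult.assoc split: if_splits)
  \<comment> \<open>The factor \<open>- h i\<close> from the commutator of \<open>Ad i\<close> with
    \<open>A i\<close> turns the correction of \<open>M i\<close> into that of \<open>B i\<close>,
    so \<open>- A i\<close> is completed to \<open>- B i\<close>.\<close>
  have MA: "commutator (M i) (A j) \<approx> (if j = i then - B i else 0)"
    if "i \<in> {1..n}" "j \<in> {1..n}" for i j
  proof -
    have "commutator (w * k i * (Ad i * S i)) (A j) \<approx>
        w * k i * ((if j = i then - h i else 0) * S i + Ad i * 0)"
      using that by (intro commutator_central_mult_left commutator_mult_left DA SA central_coeff)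
    from commutator_add_left[OF NA[of i j] this] that show ?thesis
      by (auto simp: M_eq B_eq mult.assoc split: if_splits)
  qed
  have AM: "commutator (A j) (M i) \<approx> (if j = i then B i else 0)"
    if "i \<in> {1..n}" "j \<in> {1..n}" for i j
    using commutator_swap[OF MA[OF that]] by (auto split: if_splits)
  \<comment> \<open>The tail \<open>S j\<close> contains \<open>A i\<close> exactly when
    \<open>j < i\<close>; this produces the one-sided case of the braided relation between
    \<open>M i\<close> and \<open>B j\<close>.\<close>
  have MS: "commutator (M i) (S j) \<approx> (if j < i then - (k i * B i) else 0)"
    if "i \<in> {1..n}" "j \<in> {1..n}" for i j
  proof -
    have "commutator (S j) (M i) \<approx> (if j < i then k i * B i else 0)"
      by (rule commutator_S) (use that AM in auto)
    from commutator_swap[OF this] show ?thesis by (auto split: if_splits)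
  qed
  have MB: "commutator (M i) (B j) \<approx>
      (if i < j then 0 else if i = j then - B i else - (w * k j * h j * k i * B i))"
    if "i \<in> {1..n}" "j \<in> {1..n}" for i j
    using commutator_add_right[OF MA[of i j] commutator_central_mult_right[OF central_coeff(2)[of j] MS[of i j]],
        folded B_eq] that by (auto simp: mult.assoc split: if_splits)
  have MD: "commutator (M i) (Ad j) \<approx>
      (if i < j then w * k i * Ad i * k j * h j else if i = j then Ad i else 0)"
    if "i \<in> {1..n}" "j \<in> {1..n}" for i j
  proof -
    have "commutator (w * k i * (Ad i * S i)) (Ad j) \<approx>
        w * k i * (0 * S i + Ad i * (if i < j then k j * h j else 0))"
      using that by (intro commutator_central_mult_left commutator_mult_left DD SD central_coeff)
    from commutator_add_left[OF ND[of i j] this] that show ?thesis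
      by (auto simp: M_eq mult.assoc split: if_splits)
  qed
  have MM: "commutator (M i) (M j) \<approx> w * k i * Ad i * k j * B j"
    if ij: "i \<in> {1..n}" "j \<in> {1..n}" "i < j" for i j
  proof -
    \<comment> \<open>For \<open>i < j\<close> the factor \<open>Ad i\<close> commutes with
      \<open>N j\<close>, and \<open>S i\<close> contributes through its summand
      \<open>k j * A j\<close>.\<close>
    have "commutator (w * k i * (Ad i * S i)) (N j) \<approx> w * k i * (0 * S i + Ad i * (k j * A j))"
      using ij commutator_swap[OF ND[of j i]] SN[of i j]
      by (intro commutator_central_mult_left commutator_mult_left central_coeff) auto
    from commutator_add_left[OF NN[of i j] this] ij
    have "commutator (M i) (N j) \<approx> w * k i * (Ad i * (k j * A j))"
      by (simp add: M_eq mult.assoc)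
    moreover have "commutator (M i) (w * k j * (Ad j * S j)) \<approx>
        w * k j * (w * k i * Ad i * k j * h j * S j + Ad j * 0)"
      using ij MD[of i j] MS[of i j]
      by (intro commutator_central_mult_right commutator_mult_right central_coeff) auto
    \<comment> \<open>The first summand carries \<open>A j\<close>, the second the tail
      \<open>S j\<close>. Moving the central factors \<open>w * k j\<close> and then
      \<open>w\<close> to the right allows \<open>w * k i * Ad i * k j\<close> to be factored out,
      and what remains is \<open>B j\<close>.\<close>
    ultimately have "commutator (M i) (M j) \<approx>
        w * k i * (Ad i * (k j * A j)) + w * k j * (w * k i * Ad i * k j * h j * S j + Ad j * 0)"
      using commutator_add_right by (simp add: M_eq[of j] mult.assoc)
    also have "\<dots> = w * k i * (Ad i * (k j * A j)) + w * k j * (w * k i * Ad i * (k j * h j * S j))"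
      by (simp add: mult.assoc)
    also have "\<dots> \<approx> w * k i * (Ad i * (k j * A j)) + w * k i * Ad i * (w * k j * (k j * h j * S j))"
      using ij by (intro eqv_add eqv_refl eqv_sym[OF central_move] central_coeff)
    also have "\<dots> = w * k i * (Ad i * (k j * A j)) + w * k i * Ad i * (w * (k j * (k j * h j * S j)))"
      by (simp add: mult.assoc)
    also have "\<dots> \<approx> w * k i * (Ad i * (k j * A j)) + w * k i * Ad i * (k j * (w * (k j * h j * S j)))"
      using ij by (intro eqv_add eqv_mult_left eqv_refl eqv_sym[OF central_move] central_w)
    also have "\<dots> = w * k i * Ad i * k j * B j"
      by (simp add: B_eq algebra_simps)
    finally show ?thesis .
  qed
  show ?thesis
    unfolding braided_relations_def by (intro ballI conjI impI BB DD BD MB MD MM)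
qed

text \<open>Since \<open>S i\<close> involves only \<open>A l\<close> with \<open>l > i\<close>, the
  equation \<open>A i = B i - w * k i * h i * S i\<close> determines the commutators of the
  \<open>A i\<close> by induction from the last index downwards. The statements about
  \<open>N\<close> then follow from those about \<open>M\<close> and the tails.\<close>

lemma tensor_if_braided:
  assumes braided_relations
  shows tensor_relations
proof -
  have BB: "commutator (B i) (B j) \<approx> 0"
    and DD: "commutator (Ad i) (Ad j) \<approx> 0"
    and BD: "commutator (B i) (Ad j) \<approx>
       (if i < j then w * k i * h i * k j * h j else if i = j then h i else 0)"
    and MB: "commutator (M i) (B j) \<approx>
       (if i < j then 0 else if i = j then - B i else - (w * k j * h j * k i * B i))"
    and MD: "commutator (M i) (Ad j) \<approx>
       (if i < j then w * k i * Ad i * k j * h j else if i = j then Ad i else 0)"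
    and MM: "i < j \<Longrightarrow> commutator (M i) (M j) \<approx> w * k i * Ad i * k j * B j"
    if "i \<in> {1..n}" "j \<in> {1..n}" for i j
    using assms that unfolding braided_relations_def by blast+
  have A_eq: "A i = B i - w * k i * h i * S i" for i
    by (simp add: B_eq)
  have N_eq: "N i = M i - w * k i * (Ad i * S i)" for i
    by (simp add: M_eq mult.assoc)
  have AB: "commutator (A i) (B j) \<approx> 0" if "i \<in> {1..n}" "j \<in> {1..n}" for i j
    using that(1)
  proof (induction "n - i" arbitrary: i rule: less_induct)
    case less
    then have "commutator (S i) (B j) \<approx> 0"
      by (intro commutator_S_zero) auto
    from commutator_diff_left[OF BB[of i j] commutator_central_mult_left[OF central_coeff(2)[of i] this]]
    show ?case using less.prems that by (simp add: A_eq)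
  qed
  \<comment> \<open>The first slot is settled by \<open>AB\<close>; a second downward induction
    replaces \<open>B j\<close> by \<open>A j\<close>.\<close>
  have AA: "commutator (A i) (A j) \<approx> 0" if "i \<in> {1..n}" "j \<in> {1..n}" for i j
    using that(2)
  proof (induction "n - j" arbitrary: j rule: less_induct)
    case less
    have "commutator (S j) (A i) \<approx> 0"
      using less that commutator_swap[of "A i" _ 0] by (intro commutator_S_zero) auto
    then have "commutator (A i) (S j) \<approx> 0"
      using commutator_swap[of _ _ 0] by auto
    from commutator_diff_right[OF AB[of i j] commutator_central_mult_right[OF central_coeff(2)[of j] this]]
    show ?case using less.prems that by (simp add: A_eq[of j])
  qed
  have SA: "commutator (S i) (A j) \<approx> 0" if "i \<in> {1..n}" "j \<in> {1..n}" for i j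
    by (rule commutator_S_zero) (use that AA in auto)
  have AD: "commutator (A i) (Ad j) \<approx> (if i = j then h j else 0)"
    if "i \<in> {1..n}" "j \<in> {1..n}" for i j
    using that(1)
  proof (induction "n - i" arbitrary: i rule: less_induct)
    case less
    have "commutator (A l) (Ad j) \<approx> (if l = j then h j else 0)" if "l \<in> {i<..n}" for l
      using less.hyps[of l] less.prems that by auto
    then have "commutator (S i) (Ad j) \<approx> (if i < j then k j * h j else 0)"
      using less.prems that by (intro commutator_S) auto
    \<comment> \<open>For \<open>i < j\<close> the tail contributes the same product as the braided
      relation \<open>BD\<close>, and the two cancel.\<close>
    from commutator_diff_left[OF BD[of i j] commutator_central_mult_left[OF central_coeff(2)[of i] this]]
    show ?case using less.prems that by (auto simp: A_eq mult.assoc split: if_splits)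
  qed
  have DA: "commutator (Ad i) (A j) \<approx> (if i = j then - h i else 0)"
    if "i \<in> {1..n}" "j \<in> {1..n}" for i j
    using commutator_swap[OF AD[OF that(2,1)]] by (auto split: if_splits)
  have SD: "commutator (S i) (Ad j) \<approx> (if i < j then k j * h j else 0)"
    if "i \<in> {1..n}" "j \<in> {1..n}" for i j
    by (rule commutator_S) (use that AD in auto)
  have AM: "commutator (A j) (M i) \<approx> (if j = i then B i else 0)"
    if "i \<in> {1..n}" "j \<in> {1..n}" for i j
    using that(2)
  proof (induction "n - j" arbitrary: j rule: less_induct)
    case less
    have "commutator (A l) (M i) \<approx> (if l = i then B i else 0)" if "l \<in> {j<..n}" for l
      using less.hyps[of l] less.prems that by auto
    then have SM: "commutator (S j) (M i) \<approx> (if j < i then k i * B i else 0)"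
      using less.prems that by (intro commutator_S) auto
    have "commutator (B j) (M i) \<approx>
        - (if i < j then 0 else if i = j then - B i else - (w * k j * h j * k i * B i))"
      by (rule commutator_swap[OF MB]) (use less.prems that in auto)
    \<comment> \<open>For \<open>j < i\<close> the two terms cancel, so only the diagonal value
      \<open>B i\<close> survives.\<close>
    from commutator_diff_left[OF this commutator_central_mult_left[OF central_coeff(2)[of j] SM]]
    show ?case using less.prems that by (auto simp: A_eq[of j] mult.assoc split: if_splits)
  qed
  have MA: "commutator (M i) (A j) \<approx> (if i = j then - B i else 0)"
    if "i \<in> {1..n}" "j \<in> {1..n}" for i j
    using commutator_swap[OF AM[OF that]] by (auto split: if_splits)
  have SM: "commutator (S i) (M j) \<approx> (if i < j then k j * B j else 0)"
    if "i \<in> {1..n}" "j \<in> {1..n}" for i j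
    by (rule commutator_S) (use that AM in auto)
  have NA: "commutator (N i) (A j) \<approx> (if i = j then - A i else 0)"
    if "i \<in> {1..n}" "j \<in> {1..n}" for i j
  proof -
    have "commutator (w * k i * (Ad i * S i)) (A j) \<approx>
        w * k i * ((if i = j then - h i else 0) * S i + Ad i * 0)"
      using that by (intro commutator_central_mult_left commutator_mult_left DA SA central_coeff)
    \<comment> \<open>On the diagonal the result is \<open>- B i + w * k i * h i * S i\<close>,
      which is \<open>- A i\<close>.\<close>
    from commutator_diff_left[OF MA[of i j] this] that show ?thesis
      by (auto simp: N_eq B_eq mult.assoc split: if_splits)
  qed
  have ND: "commutator (N i) (Ad j) \<approx> (if i = j then Ad i else 0)"
    if "i \<in> {1..n}" "j \<in> {1..n}" for i j
  proof -
    have "commutator (w * k i * (Ad i * S i)) (Ad j) \<approx>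
        w * k i * (0 * S i + Ad i * (if i < j then k j * h j else 0))"
      using that by (intro commutator_central_mult_left commutator_mult_left DD SD central_coeff)
    from commutator_diff_left[OF MD[of i j] this] that show ?thesis
      by (auto simp: N_eq mult.assoc split: if_splits)
  qed
  have NN_less: "commutator (N i) (N j) \<approx> 0"
    if ij: "i \<in> {1..n}" "j \<in> {1..n}" "i < j" for i j
  proof -
    \<comment> \<open>For \<open>i < j\<close> the factor \<open>Ad i\<close> commutes with
      \<open>M j\<close>, and \<open>S i\<close> contributes \<open>k j * B j\<close>; this is
      exactly the braided value of the commutator of \<open>M i\<close> and \<open>M j\<close>, so
      the difference vanishes.\<close>
    have "commutator (w * k i * (Ad i * S i)) (M j) \<approx> w * k i * (0 * S i + Ad i * (k j * B j))"
      using ij commutator_swap[OF MD[of j i]] SM[of i j]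
      by (intro commutator_central_mult_left commutator_mult_left central_coeff) auto
    from commutator_diff_left[OF MM[of i j] this] ij
    have NM: "commutator (N i) (M j) \<approx> 0"
      by (simp add: N_eq mult.assoc)
    \<comment> \<open>As \<open>i < j < l\<close>, \<open>N i\<close> commutes with every summand of
      \<open>S j\<close> and with \<open>Ad j\<close>, hence with the whole correction that
      separates \<open>N j\<close> from \<open>M j\<close>.\<close>
    have "commutator (A l) (N i) \<approx> 0" if "l \<in> {j<..n}" for l
      using ij that commutator_swap[OF NA[of i l]] by auto
    then have "commutator (S j) (N i) \<approx> 0"
      using ij by (intro commutator_S_zero) auto
    then have "commutator (N i) (S j) \<approx> 0"
      using commutator_swap[of _ _ 0] by auto
    then have "commutator (N i) (w * k j * (Ad j * S j)) \<approx> w * k j * (0 * S j + Ad j * 0)"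
      using ij ND[of i j]
      by (intro commutator_central_mult_right commutator_mult_right central_coeff) auto
    from commutator_diff_right[OF NM this] show ?thesis
      by (simp add: N_eq[of j])
  qed
  have NN: "commutator (N i) (N j) \<approx> 0" if "i \<in> {1..n}" "j \<in> {1..n}" for i j
    using NN_less[OF that] commutator_swap[OF NN_less[OF that(2,1)]]
    by (cases i j rule: linorder_cases) (auto simp: commutator_def)
  have AD': "commutator (A i) (Ad j) \<approx> (if i = j then h i else 0)"
    if "i \<in> {1..n}" "j \<in> {1..n}" for i j
    using AD[OF that] by (auto split: if_splits)
  show ?thesis
    unfolding tensor_relations_def by (intro ballI conjI AA DD AD' NA ND NN)
qed

end

section \<open>Substitution in free algebras\<close>

lemma scal_zero [simp]: "scal 0 = 0"
  by (simp add: scal_def)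

lemma scal_one [simp]: "scal 1 = 1"
  by (simp add: scal_def)

lemma scal_add: "scal (c + d) = scal c + scal d"
  by (simp add: scal_def single_add)

lemma scal_mult: "scal (c * d) = scal c * scal d"
  by (simp add: scal_def mult_single)

lemma ncpoly_eq_sum: "p = (\<Sum>w\<in>Poly_Mapping.keys p. Poly_Mapping.single w (Poly_Mapping.lookup p w))"
  by (rule poly_mapping_eqI)
    (simp add: lookup_sum lookup_single when_def in_keys_iff)

lemma ncpoly_induct [case_names single add]:
  assumes "\<And>w c. P (Poly_Mapping.single w c)" and "\<And>p q. P p \<Longrightarrow> P q \<Longrightarrow> P (p + q)"
  shows "P (p :: 'g ncpoly)"
proof -
  have "P (\<Sum>w\<in>W. Poly_Mapping.single w (Poly_Mapping.lookup p w))" for W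
    \<comment> \<open>The empty sum is the monomial with coefficient 0.\<close>
    by (induction W rule: infinite_finite_induct)
      (use assms(1)[of 0 0] in \<open>auto intro: assms\<close>)
  then show ?thesis
    using ncpoly_eq_sum[of p] by metis
qed

lemma scal_commute: "p * scal c = scal c * p"
  by (induction p rule: ncpoly_induct) (simp_all add: scal_def mult_single algebra_simps)

lemma single_word: "Poly_Mapping.single w c = scal c * prod_list (map gen (letters w))"
proof -
  have "prod_list (map gen xs) = Poly_Mapping.single (Word xs) 1" for xs :: "'a list"
    by (induction xs) (simp_all add: gen_def mult_single plus_word_def flip: zero_word_def)
  then show ?thesis by (simp add: scal_def mult_single)
qed

text \<open>The homomorphism given by the universal property of the free algebra;
  \<open>subst_add\<close>, \<open>subst_mult\<close> and \<open>subst_scal\<close> confirm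
  this.\<close>

definition subst :: "('g \<Rightarrow> 'h ncpoly) \<Rightarrow> 'g ncpoly \<Rightarrow> 'h ncpoly" where
  "subst f p = (\<Sum>w\<in>Poly_Mapping.keys p.
     scal (Poly_Mapping.lookup p w) * prod_list (map f (letters w)))"

text \<open>Cancellation can make the support of a sum smaller than the union of the supports; this
  allows all three sums in \<open>subst_add\<close> to run over that union.\<close>

lemma subst_superset:
  assumes "finite W" "Poly_Mapping.keys p \<subseteq> W"
  shows "subst f p = (\<Sum>w\<in>W. scal (Poly_Mapping.lookup p w) * prod_list (map f (letters w)))"
  unfolding subst_def using assms by (intro sum.mono_neutral_left) (auto simp: in_keys_iff)

lemma subst_add: "subst f (p + q) = subst f p + subst f q"
proof -
  let ?W = "Poly_Mapping.keys p \<union> Poly_Mapping.keys q"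
  have "Poly_Mapping.keys (p + q) \<subseteq> ?W" by (rule Poly_Mapping.keys_add)
  then show ?thesis
    by (simp add: subst_superset[of ?W] lookup_add scal_add distrib_right sum.distrib)
qed

lemma subst_zero [simp]: "subst f 0 = 0"
  by (simp add: subst_def)

lemma subst_single: "subst f (Poly_Mapping.single w c) = scal c * prod_list (map f (letters w))"
  by (simp add: subst_def)

lemma subst_scal [simp]: "subst f (scal c) = scal c"
  using subst_single[of f 0 c] by (simp add: scal_def) (simp add: zero_word_def)

lemma subst_one [simp]: "subst f 1 = 1"
  using subst_scal[of f 1] by simp

lemma subst_gen [simp]: "subst f (gen x) = f x"
  by (simp add: gen_def subst_single)

lemma subst_uminus: "subst f (- p) = - subst f p"
  using subst_add[of f "- p" p] by (simp add: eq_neg_iff_add_eq_0)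

lemma subst_diff: "subst f (p - q) = subst f p - subst f q"
  using subst_add[of f p "- q"] by (simp add: subst_uminus)

text \<open>Additivity reduces the claim to monomials, where concatenated words become products and
  the scalar in the middle commutes with everything.\<close>

lemma subst_mult: "subst f (p * q) = subst f p * subst f q"
proof (induction p rule: ncpoly_induct)
  case (single w c)
  show ?case
  proof (induction q rule: ncpoly_induct)
    case (single v d)
    let ?W = "prod_list (map f (letters w))" and ?V = "prod_list (map f (letters v))"
    have "subst f (Poly_Mapping.single w c * Poly_Mapping.single v d) = scal c * (scal d * ?W) * ?V"
      by (simp add: mult_single subst_single plus_word_def scal_mult mult.assoc)
    also have "\<dots> = scal c * (?W * scal d) * ?V"
      by (simp only: scal_commute)
    finally show ?case
      by (simp add: subst_single mult.assoc)
  qed (simp add: subst_add distrib_left)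
qed (simp add: subst_add distrib_right)

lemma subst_power: "subst f (p ^ m) = subst f p ^ m"
  by (induction m) (simp_all add: subst_mult)

lemma subst_sum: "subst f (sum p I) = (\<Sum>i\<in>I. subst f (p i))"
  by (induction I rule: infinite_finite_induct) (simp_all add: subst_add)

lemma subst_commutator: "subst f (commutator p q) = commutator (subst f p) (subst f q)"
  by (simp add: commutator_def subst_diff subst_mult)

lemmas subst_simps = subst_add subst_diff subst_uminus subst_mult subst_power subst_sum
  subst_commutator

lemma subst_cong:
  assumes "p \<in> ncpolys X" and "\<And>x. x \<in> X \<Longrightarrow> f x = g x"
  shows "subst f p = subst g p"
proof -
  have "map f (letters w) = map g (letters w)" if "w \<in> Poly_Mapping.keys p" for w
    using assms that by (auto simp: carrier_free_algebra)
  then show ?thesis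
    unfolding subst_def by (intro sum.cong) (simp_all cong: map_cong)
qed

lemma subst_gen_id: "subst gen p = p"
  by (subst (2) ncpoly_eq_sum) (simp add: subst_def single_word)

lemma subst_id: "p \<in> ncpolys X \<Longrightarrow> (\<And>x. x \<in> X \<Longrightarrow> f x = gen x) \<Longrightarrow> subst f p = p"
  using subst_cong[of p X f gen] by (simp add: subst_gen_id)

lemma subst_subst: "subst g (subst f p) = subst (\<lambda>x. subst g (f x)) p"
proof -
  have "subst g (prod_list ps) = prod_list (map (subst g) ps)" for ps
    by (induction ps) (simp_all add: subst_mult)
  then show ?thesis
    by (simp add: subst_def[of f] subst_def[of "\<lambda>x. subst g (f x)"] subst_sum subst_mult comp_def)
qed

lemma ncpolys_sum: "(\<And>i. i \<in> I \<Longrightarrow> f i \<in> ncpolys X) \<Longrightarrow> sum f I \<in> ncpolys X"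
  by (induction I rule: infinite_finite_induct) (auto intro!: ncpolys_zero ncpolys_add)

lemma subst_closed:
  assumes "p \<in> ncpolys X" and "\<And>x. x \<in> X \<Longrightarrow> f x \<in> ncpolys Y"
  shows "subst f p \<in> ncpolys Y"
proof -
  have "prod_list (map f xs) \<in> ncpolys Y" if "set xs \<subseteq> X" for xs
    using that assms(2) by (induction xs) (auto intro!: ncpolys_one ncpolys_mult)
  then show ?thesis
    unfolding subst_def using assms(1)
    by (intro ncpolys_sum ncpolys_mult ncpolys_scal) (auto simp: carrier_free_algebra)
qed

section \<open>Isomorphisms of presented algebras\<close>

lemma free_algebra_coset: "I +>\<^bsub>free_algebra X\<^esub> p = (\<lambda>i. i + p) ` I"
  by (auto simp: a_r_coset_def r_coset_def free_algebra_ops)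

lemma presented_algebra_ops:
  fixes X R
  defines "I \<equiv> Idl\<^bsub>free_algebra X\<^esub> R"
  shows "carrier (presented_algebra X R) = {I +>\<^bsub>free_algebra X\<^esub> p | p. p \<in> ncpolys X}"
    and "mult (presented_algebra X R) = rcoset_mult (free_algebra X) I"
    and "one (presented_algebra X R) = I +>\<^bsub>free_algebra X\<^esub> 1"
    and "add (presented_algebra X R) = set_add (free_algebra X)"
    and "smult (presented_algebra X R) = (\<lambda>c C. \<Union>p\<in>C. I +>\<^bsub>free_algebra X\<^esub> (scal c * p))"
proof -
  have "smult (free_algebra X) = (\<lambda>c p. scal c * p)"
    by (simp add: free_algebra_def)
  then show "carrier (presented_algebra X R) = {I +>\<^bsub>free_algebra X\<^esub> p | p. p \<in> ncpolys X}"
    "mult (presented_algebra X R) = rcoset_mult (free_algebra X) I"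
    "one (presented_algebra X R) = I +>\<^bsub>free_algebra X\<^esub> 1"
    "add (presented_algebra X R) = set_add (free_algebra X)"
    "smult (presented_algebra X R) = (\<lambda>c C. \<Union>p\<in>C. I +>\<^bsub>free_algebra X\<^esub> (scal c * p))"
    by (auto simp: presented_algebra_def quot_algebra_def FactRing_def A_RCOSETS_def'
        I_def free_algebra_ops)
qed

text \<open>The preimage of \<open>J\<close> is an ideal that contains \<open>R\<close>, hence also
  the ideal generated by \<open>R\<close>.\<close>

lemma subst_genideal:
  assumes "\<And>x. x \<in> X \<Longrightarrow> f x \<in> ncpolys Y" "ideal J (free_algebra Y)"
    and "R \<subseteq> ncpolys X" "subst f ` R \<subseteq> J"
  shows "subst f ` (Idl\<^bsub>free_algebra X\<^esub> R) \<subseteq> J"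
proof -
  have "ring_hom_ring (free_algebra X) (free_algebra Y) (subst f)"
    using assms(1) by (intro ring_hom_ringI ring_free_algebra)
      (auto simp: free_algebra_ops subst_simps intro: subst_closed)
  then have "ideal {p \<in> ncpolys X. subst f p \<in> J} (free_algebra X)"
    using assms(2) by (rule ring_hom_ring.ideal_vimage)
  then have "Idl\<^bsub>free_algebra X\<^esub> R \<subseteq> {p \<in> ncpolys X. subst f p \<in> J}"
    using assms(3,4) by (intro ring.genideal_minimal ring_free_algebra) auto
  then show ?thesis by auto
qed

text \<open>The two substitutions are mutually inverse on the free algebras and each carries one
  ideal into the other. So \<open>subst f\<close> matches the ideals exactly and descends to the
  quotients as the direct image of cosets.\<close>

lemma presented_algebra_iso:
  assumes f: "\<And>x. x \<in> X \<Longrightarrow> f x \<in> ncpolys Y" and g: "\<And>y. y \<in> Y \<Longrightarrow> g y \<in> ncpolys X"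
    and gf: "\<And>x. x \<in> X \<Longrightarrow> subst g (f x) = gen x" and fg: "\<And>y. y \<in> Y \<Longrightarrow> subst f (g y) = gen y"
    and R: "R \<subseteq> ncpolys X" and Q: "Q \<subseteq> ncpolys Y"
    and fR: "subst f ` R \<subseteq> Idl\<^bsub>free_algebra Y\<^esub> Q" and gQ: "subst g ` Q \<subseteq> Idl\<^bsub>free_algebra X\<^esub> R"
  shows "algebras_isomorphic (presented_algebra X R) (presented_algebra Y Q)"
proof -
  define I where "I = Idl\<^bsub>free_algebra X\<^esub> R"
  define J where "J = Idl\<^bsub>free_algebra Y\<^esub> Q"
  have ideal_I: "ideal I (free_algebra X)" and ideal_J: "ideal J (free_algebra Y)"
    unfolding I_def J_def using R Q by (auto intro: ring.genideal_ideal ring_free_algebra)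
  have I_sub: "I \<subseteq> ncpolys X" and J_sub: "J \<subseteq> ncpolys Y"
    using ideal.Icarr[OF ideal_I] ideal.Icarr[OF ideal_J] by auto
  have inv_gf: "subst g (subst f p) = p" if "p \<in> ncpolys X" for p
    using that gf by (simp add: subst_subst subst_id)
  have inv_fg: "subst f (subst g p) = p" if "p \<in> ncpolys Y" for p
    using that fg by (simp add: subst_subst subst_id)
  have fI: "subst f ` I \<subseteq> J"
    unfolding I_def using f ideal_J R fR[folded J_def] by (rule subst_genideal)
  have gJ: "subst g ` J \<subseteq> I"
    unfolding J_def using g ideal_I Q gQ[folded I_def] by (rule subst_genideal)
  have coset: "subst f ` (I +>\<^bsub>free_algebra X\<^esub> p) = J +>\<^bsub>free_algebra Y\<^esub> subst f p" for p
  proof -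
    \<comment> \<open>Equality, not mere inclusion, is required for the image of a coset to be a
      whole coset. Surjectivity onto \<open>J\<close> comes from \<open>g\<close>.\<close>
    have "subst f ` I = J"
    proof
      show "J \<subseteq> subst f ` I"
      proof
        fix q assume "q \<in> J"
        then have "q = subst f (subst g q)" "subst g q \<in> I"
          using inv_fg J_sub gJ by auto
        then show "q \<in> subst f ` I" by blast
      qed
    qed (rule fI)
    then show ?thesis
      by (auto simp: free_algebra_coset image_image subst_add)
  qed
  let ?S = "presented_algebra X R" and ?T = "presented_algebra Y Q"
  note S = presented_algebra_ops[of X R, folded I_def]
  note T = presented_algebra_ops[of Y Q, folded J_def]
  have coset_sub: "C \<subseteq> ncpolys X" if "C \<in> carrier ?S" for C
    using that I_sub by (auto simp: S free_algebra_coset)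
  have f_closed: "subst f p \<in> ncpolys Y" if "p \<in> ncpolys X" for p
    using that f by (rule subst_closed)
  have inj: "inj_on (subst f) (ncpolys X)"
    using inv_gf by (rule inj_on_inverseI)
  have "bij_betw ((`) (subst f)) (carrier ?S) (carrier ?T)"
  proof (rule bij_betw_imageI)
    show "inj_on ((`) (subst f)) (carrier ?S)"
      using inj coset_sub by (intro inj_onI) (auto simp: inj_on_image_eq_iff)
    have "J +>\<^bsub>free_algebra Y\<^esub> q \<in> (`) (subst f) ` carrier ?S" if q: "q \<in> ncpolys Y" for q
    proof (rule image_eqI)
      show "J +>\<^bsub>free_algebra Y\<^esub> q = subst f ` (I +>\<^bsub>free_algebra X\<^esub> subst g q)"
        using q by (simp add: coset inv_fg)
      show "I +>\<^bsub>free_algebra X\<^esub> subst g q \<in> carrier ?S"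
        using q g by (auto simp: S intro: subst_closed)
    qed
    moreover have "(`) (subst f) ` carrier ?S \<subseteq> carrier ?T"
      using f_closed by (auto simp: S T coset; blast)
    ultimately show "(`) (subst f) ` carrier ?S = carrier ?T"
      by (auto simp: T)
  qed
  moreover have "(`) (subst f) \<in> ring_hom ?S ?T"
  proof (rule ring_hom_memI)
    show "subst f ` C \<in> carrier ?T" if "C \<in> carrier ?S" for C
      using that f_closed by (auto simp: S T coset; blast)
    \<comment> \<open>The product of two cosets is a union of cosets over representatives, and
      direct images commute with unions.\<close>
    show "subst f ` (C \<otimes>\<^bsub>?S\<^esub> D) = subst f ` C \<otimes>\<^bsub>?T\<^esub> subst f ` D" for C D
      by (simp add: S T rcoset_mult_def image_UN coset free_algebra_ops subst_mult)
    show "subst f ` (C \<oplus>\<^bsub>?S\<^esub> D) = subst f ` C \<oplus>\<^bsub>?T\<^esub> subst f ` D" for C D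
      by (simp add: S T set_add_def set_mult_def image_UN free_algebra_ops subst_add)
    show "subst f ` \<one>\<^bsub>?S\<^esub> = \<one>\<^bsub>?T\<^esub>"
      by (simp add: S T coset)
  qed
  moreover have "subst f ` (c \<odot>\<^bsub>?S\<^esub> C) = c \<odot>\<^bsub>?T\<^esub> subst f ` C" for c C
    by (simp add: S T image_UN coset subst_mult)
  ultimately have "(`) (subst f) \<in> algebra_iso ?S ?T"
    by (simp add: algebra_iso_def ring_iso_def)
  then show ?thesis by (auto simp: algebras_isomorphic_def)
qed

text \<open>Sending the generators outside \<open>X\<close> to \<open>0\<close> makes the ideal of relations available in the
  whole type, where no carrier conditions are needed.\<close>

definition retract :: "'g set \<Rightarrow> 'g ncpoly \<Rightarrow> 'g ncpoly" where
  "retract X = subst (\<lambda>x. if x \<in> X then gen x else 0)"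

definition relation_ideal :: "'g set \<Rightarrow> 'g ncpoly set \<Rightarrow> 'g ncpoly set" where
  "relation_ideal X R = {p. retract X p \<in> Idl\<^bsub>free_algebra X\<^esub> R}"

lemma retract_id: "p \<in> ncpolys X \<Longrightarrow> retract X p = p"
  unfolding retract_def by (rule subst_id) auto

lemma retract_closed: "retract X p \<in> ncpolys X"
  unfolding retract_def
  by (rule subst_closed[of _ UNIV]) (auto simp: carrier_free_algebra gen_def)

lemma relation_ideal_iff:
  "p \<in> ncpolys X \<Longrightarrow> p \<in> relation_ideal X R \<longleftrightarrow> p \<in> Idl\<^bsub>free_algebra X\<^esub> R"
  by (simp add: relation_ideal_def retract_id)

lemma two_sided_relation_ideal:
  assumes "R \<subseteq> ncpolys X"
  shows "two_sided_ideal (relation_ideal X R)"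
proof -
  interpret ideal "Idl\<^bsub>free_algebra X\<^esub> R" "free_algebra X"
    using assms by (intro ring.genideal_ideal ring_free_algebra)
  note hom = retract_def subst_simps
  show ?thesis
  proof
    show "0 \<in> relation_ideal X R"
      using additive_subgroup.zero_closed[OF is_additive_subgroup]
      by (simp add: relation_ideal_def retract_def free_algebra_ops)
    fix p q assume p: "p \<in> relation_ideal X R"
    have mult: "a * retract X p \<in> Idl\<^bsub>free_algebra X\<^esub> R" "retract X p * a \<in> Idl\<^bsub>free_algebra X\<^esub> R"
      if "a \<in> ncpolys X" for a
      using p that I_l_closed[of "retract X p" a] I_r_closed[of "retract X p" a]
      by (simp_all add: relation_ideal_def free_algebra_ops)
    then show "q * p \<in> relation_ideal X R" "p * q \<in> relation_ideal X R"
      using retract_closed[of X q] by (simp_all add: relation_ideal_def retract_def subst_mult)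
    assume q: "q \<in> relation_ideal X R"
    \<comment> \<open>The difference is formed by adding the multiple by -1, which the ideal
      contains by closure under left multiplication.\<close>
    have "- 1 * retract X q \<in> Idl\<^bsub>free_algebra X\<^esub> R"
      using q I_l_closed[of "retract X q" "- 1"] ncpolys_uminus[OF ncpolys_one, of X]
      by (simp add: relation_ideal_def free_algebra_ops)
    then show "p - q \<in> relation_ideal X R"
      using p additive_subgroup.a_closed[OF is_additive_subgroup, of "retract X p" "- 1 * retract X q"]
      by (simp add: relation_ideal_def retract_def free_algebra_ops subst_diff)
  qed
qed

lemma relation_mem_ideal: "R \<subseteq> ncpolys X \<Longrightarrow> r \<in> R \<Longrightarrow> r \<in> relation_ideal X R"
  using ring.genideal_self[OF ring_free_algebra, of R X] relation_ideal_iff[of r X R] by blast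

text \<open>A foreign generator retracts to 0. Commutators with it therefore vanish modulo the
  ideal, as \<open>central\<close> demands of every element of the type.\<close>

lemma gen_mem_relation_ideal:
  assumes "R \<subseteq> ncpolys X" "x \<notin> X"
  shows "gen x \<in> relation_ideal X R"
  using two_sided_ideal.zero_mem[OF two_sided_relation_ideal[OF assms(1)]] assms(2)
  by (simp add: relation_ideal_def retract_def)

text \<open>By the Leibniz rule, the elements commuting with \<open>c\<close> modulo
  \<open>K\<close> are closed under sums and products; they contain the scalars, so the generators
  suffice.\<close>

lemma central_if_commutes_gens:
  assumes "two_sided_ideal K" and "\<And>x. commutator c (gen x) \<in> K"
  shows "two_sided_ideal.central K c"
proof -
  interpret two_sided_ideal K by fact
  have word: "commutator c (prod_list (map gen xs)) \<approx> 0" for xs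
  proof (induction xs)
    case Nil
    show ?case by (simp add: commutator_def)
  next
    case (Cons x xs)
    then show ?case
      using commutator_mult_right[of c "gen x" 0 _ 0] assms(2)[of x] by (simp add: mem_iff_eqv_zero)
  qed
  have "commutator c p \<approx> 0" for p
  proof (induction p rule: ncpoly_induct)
    case (single w d)
    have "commutator c (scal d) \<approx> 0"
      by (simp add: commutator_def scal_commute)
    from commutator_mult_right[OF this word] show ?case
      by (simp add: single_word)
  next
    case (add p q)
    then show ?case using commutator_add_right[of c p 0 q 0] by simp
  qed
  then show ?thesis by (simp add: central_def)
qed

lemma central_scal: "two_sided_ideal K \<Longrightarrow> two_sided_ideal.central K (scal c)"
  by (rule central_if_commutes_gens)
    (auto simp: commutator_def scal_commute two_sided_ideal.zero_mem)

section \<open>The isomorphism\<close>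

definition twist :: "complex \<Rightarrow> nat \<Rightarrow> heis_gen ncpoly" where
  "twist \<omega> i = scal \<omega> * gE' i * brH \<omega> i"

definition ann_tail :: "nat \<Rightarrow> nat \<Rightarrow> heis_gen ncpoly" where
  "ann_tail n i = (\<Sum>l\<in>{i<..n}. gE' l * gA l)"

text \<open>The images of the braided generators in the ordinary tensor product. The coefficients of
  the tails consist of fixed generators and scalars, and the tails involve only larger indices;
  these two facts make the substitution invertible.\<close>

fun braid :: "complex \<Rightarrow> nat \<Rightarrow> heis_gen \<Rightarrow> heis_gen ncpoly" where
  "braid \<omega> n (Ann i) = gA i + twist \<omega> i * ann_tail n i"
| "braid \<omega> n (Num i) = gN i + scal \<omega> * gE' i * gAd i * ann_tail n i"
| "braid \<omega> n x = gen x"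

text \<open>Back substitution in the triangular system: the equation for index \<open>i\<close> is
  solved once all larger indices are. For \<open>i\<close> at least \<open>n\<close> the sum is
  empty.\<close>

function ann_unbraid :: "complex \<Rightarrow> nat \<Rightarrow> nat \<Rightarrow> heis_gen ncpoly" where
  "ann_unbraid \<omega> n i = gA i - twist \<omega> i * (\<Sum>l\<in>{i<..n}. gE' l * ann_unbraid \<omega> n l)"
  by auto
termination by (relation "measure (\<lambda>(\<omega>, n, i). n - i)") auto

declare ann_unbraid.simps [simp del]

definition unbraid_tail :: "complex \<Rightarrow> nat \<Rightarrow> nat \<Rightarrow> heis_gen ncpoly" where
  "unbraid_tail \<omega> n i = (\<Sum>l\<in>{i<..n}. gE' l * ann_unbraid \<omega> n l)"

fun unbraid :: "complex \<Rightarrow> nat \<Rightarrow> heis_gen \<Rightarrow> heis_gen ncpoly" where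
  "unbraid \<omega> n (Ann i) = ann_unbraid \<omega> n i"
| "unbraid \<omega> n (Num i) = gN i - scal \<omega> * gE' i * gAd i * unbraid_tail \<omega> n i"
| "unbraid \<omega> n x = gen x"

section \<open>The two substitutions are mutually inverse\<close>

lemma subst_brH:
  "subst (braid \<omega> n) (brH \<omega>' i) = brH \<omega>' i" "subst (unbraid \<omega> n) (brH \<omega>' i) = brH \<omega>' i"
  by (simp_all add: brH_def subst_simps)

lemma subst_twist:
  "subst (braid \<omega> n) (twist \<omega>' i) = twist \<omega>' i" "subst (unbraid \<omega> n) (twist \<omega>' i) = twist \<omega>' i"
  by (simp_all add: twist_def subst_simps subst_brH)

lemma subst_unbraid_ann_tail: "subst (unbraid \<omega> n) (ann_tail n i) = unbraid_tail \<omega> n i"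
  by (simp add: ann_tail_def unbraid_tail_def subst_simps)

lemma subst_braid_ann_unbraid: "subst (braid \<omega> n) (ann_unbraid \<omega> n i) = gA i"
proof (induction "n - i" arbitrary: i rule: less_induct)
  case less
  \<comment> \<open>By induction each summand beyond \<open>i\<close> is already back to a
    generator, so the subtracted sum becomes the very tail that \<open>braid\<close> adds to
    \<open>gA i\<close>.\<close>
  have "(\<Sum>l\<in>{i<..n}. gE' l * subst (braid \<omega> n) (ann_unbraid \<omega> n l)) = ann_tail n i"
    unfolding ann_tail_def by (intro sum.cong refl arg_cong2[of _ _ _ _ "(*)"] less) auto
  then show ?case
    by (subst ann_unbraid.simps) (simp add: subst_simps subst_twist)
qed

lemma subst_braid_unbraid_tail: "subst (braid \<omega> n) (unbraid_tail \<omega> n i) = ann_tail n i"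
  by (simp add: ann_tail_def unbraid_tail_def subst_simps subst_braid_ann_unbraid)

text \<open>In this order a single use of the recursion equation suffices: \<open>unbraid\<close>
  turns \<open>ann_tail\<close> into \<open>unbraid_tail\<close>, which cancels the term subtracted
  in \<open>ann_unbraid\<close>.\<close>

lemma unbraid_braid: "subst (unbraid \<omega> n) (braid \<omega> n x) = gen x"
proof (cases x)
  case (Ann i)
  have "ann_unbraid \<omega> n i = gA i - twist \<omega> i * unbraid_tail \<omega> n i"
    unfolding unbraid_tail_def by (rule ann_unbraid.simps)
  with Ann show ?thesis
    by (simp add: subst_simps subst_twist subst_unbraid_ann_tail)
qed (simp_all add: subst_simps subst_unbraid_ann_tail)

lemma braid_unbraid: "subst (braid \<omega> n) (unbraid \<omega> n x) = gen x"
  by (cases x) (simp_all add: subst_simps subst_braid_unbraid_tail subst_braid_ann_unbraid)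

lemma gens_closed:
  assumes "i \<in> {1..n}"
  shows "gA i \<in> ncpolys (heis_gens n)" "gAd i \<in> ncpolys (heis_gens n)"
    "gN i \<in> ncpolys (heis_gens n)" "gH i \<in> ncpolys (heis_gens n)"
    "gE i \<in> ncpolys (heis_gens n)" "gE' i \<in> ncpolys (heis_gens n)"
    "brH \<omega> i \<in> ncpolys (heis_gens n)" "twist \<omega> i \<in> ncpolys (heis_gens n)"
  using assms unfolding twist_def brH_def power2_eq_square
  by (auto intro!: ncpolys_gen ncpolys_mult ncpolys_diff ncpolys_scal simp: heis_gens_def)

lemma ann_unbraid_closed: "i \<in> {1..n} \<Longrightarrow> ann_unbraid \<omega> n i \<in> ncpolys (heis_gens n)"
proof (induction "n - i" arbitrary: i rule: less_induct)
  case less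
  then show ?case
    by (subst ann_unbraid.simps) (auto intro!: ncpolys_diff ncpolys_mult ncpolys_sum gens_closed)
qed

lemma heis_gens_cases:
  assumes "x \<in> heis_gens n"
  obtains i where "i \<in> {1..n}" "x \<in> {Ann i, Cre i, Num i, Cen i, Exp i, ExpInv i}"
  using assms by (auto simp: heis_gens_def)

lemma braid_closed: "x \<in> heis_gens n \<Longrightarrow> braid \<omega> n x \<in> ncpolys (heis_gens n)"
  by (erule heis_gens_cases)
    (auto simp: ann_tail_def intro!: ncpolys_add ncpolys_mult ncpolys_sum ncpolys_scal gens_closed)

lemma unbraid_closed: "x \<in> heis_gens n \<Longrightarrow> unbraid \<omega> n x \<in> ncpolys (heis_gens n)"
  by (erule heis_gens_cases)
    (auto simp: unbraid_tail_def
      intro!: ncpolys_diff ncpolys_mult ncpolys_sum ncpolys_scal gens_closed ann_unbraid_closed)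

text \<open>What the two presentations share. It is used with the target of each substitution:
  \<open>tensor_rels\<close> for \<open>braid\<close> and \<open>braided_rels\<close> for
  \<open>unbraid\<close>.\<close>

locale heis_relations =
  fixes n R
  assumes central_rels: "central_rels n \<subseteq> R" and R_sub: "R \<subseteq> ncpolys (heis_gens n)"
begin

abbreviation "K \<equiv> relation_ideal (heis_gens n) R"

sublocale two_sided_ideal K
  by (rule two_sided_relation_ideal[OF R_sub])

lemma central_gens:
  assumes "i \<in> {1..n}"
  shows "central (gH i)" "central (gE i)" "central (gE' i)"
proof -
  have *: "central c" if c: "\<And>x. x \<in> heis_gens n \<Longrightarrow> commutator c (gen x) \<in> central_rels n" for c
  proof (rule central_if_commutes_gens)
    fix x show "commutator c (gen x) \<in> K"
    proof (cases "x \<in> heis_gens n")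
      case True
      then show ?thesis using relation_mem_ideal[OF R_sub] c central_rels by blast
    next
      case False
      then show ?thesis
        using gen_mem_relation_ideal[OF R_sub False] unfolding commutator_def
        by (intro diff_mem mult_left_mem mult_right_mem)
    qed
  qed (rule two_sided_ideal_axioms)
  show "central (gH i)" "central (gE i)" "central (gE' i)"
    using assms by (intro *; unfold central_rels_def; blast)+
qed

lemma central_brH: "i \<in> {1..n} \<Longrightarrow> central (brH \<omega> i)"
  unfolding brH_def power2_eq_square
  by (intro central_mult central_diff central_scal central_gens two_sided_ideal_axioms)

text \<open>The inversion relations are fixed. In the commutator relations \<open>gen x\<close>
  becomes an arbitrary polynomial \<open>f x\<close>, which is why centrality modulo
  \<open>K\<close> against all elements is called for.\<close>

lemma subst_central_rels:
  assumes "\<And>i. f (Cen i) = gH i" "\<And>i. f (Exp i) = gE i" "\<And>i. f (ExpInv i) = gE' i"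
    and "r \<in> central_rels n"
  shows "subst f r \<in> K"
proof -
  have "gE i * gE' i - 1 \<in> K" "gE' i * gE i - 1 \<in> K" if "i \<in> {1..n}" for i
    using that
    by (intro relation_mem_ideal[OF R_sub] central_rels[THEN subsetD]; unfold central_rels_def; blast)+
  then show ?thesis
    using assms central_gens central_commutator(1)
    by (auto simp: central_rels_def subst_simps mem_iff_eqv_zero)
qed

end

lemma braid_relations:
  assumes "r \<in> braided_rels \<omega> n"
  shows "subst (braid \<omega> n) r \<in> relation_ideal (heis_gens n) (tensor_rels \<omega> n)"
proof -
  interpret heis_relations n "tensor_rels \<omega> n"
    by (rule heis_relations.intro[OF _ tensor_rels_subset]) (auto simp only: tensor_rels_def)
  \<comment> \<open>Here \<open>A\<close>, \<open>N\<close> are the generators of the tensor product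
    and \<open>B\<close>, \<open>M\<close> their images under \<open>braid\<close>, so the braided
    relations for \<open>B\<close>, \<open>M\<close> are the substituted braided relations.\<close>
  interpret triangular_change K n "scal \<omega>" gE' "brH \<omega>" gA gAd gN
    "\<lambda>i. braid \<omega> n (Ann i)" "\<lambda>i. braid \<omega> n (Num i)" "ann_tail n"
    by standard (simp_all add: central_scal two_sided_ideal_axioms central_gens central_brH
        ann_tail_def twist_def)
  have tensor_relations
    unfolding tensor_relations_def eqv_def
  proof (intro ballI conjI)
    fix i j assume ij: "i \<in> {1..n}" "j \<in> {1..n}"
    show "commutator (gA i) (gA j) - 0 \<in> K" "commutator (gAd i) (gAd j) - 0 \<in> K"
      "commutator (gA i) (gAd j) - (if i = j then brH \<omega> i else 0) \<in> K"
      "commutator (gN i) (gA j) - (if i = j then - gA i else 0) \<in> K"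
      "commutator (gN i) (gAd j) - (if i = j then gAd i else 0) \<in> K"
      "commutator (gN i) (gN j) - 0 \<in> K"
      by (rule relation_mem_ideal[OF tensor_rels_subset],
          rule subsetD[OF equalityD2[OF tensor_rels_def]],
          rule UnI2, rule UN_I[OF ij(1)], rule UN_I[OF ij(2)], simp)+
  qed
  then have braided_relations by (rule braided_if_tensor)
  note rels = this[unfolded braided_relations_def eqv_def, rule_format]
  from assms consider (central) "r \<in> central_rels n"
    | (pair) i j where "i \<in> {1..n}" "j \<in> {1..n}"
        "r \<in> {commutator (gA i) (gA j),
         commutator (gAd i) (gAd j),
         commutator (gA i) (gAd j) -
           (if i < j then scal \<omega> * gE' i * brH \<omega> i * gE' j * brH \<omega> j
            else if i = j then brH \<omega> i else 0),
         commutator (gN i) (gA j) -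
           (if i < j then 0
            else if i = j then - gA i
            else - (scal \<omega> * gE' j * brH \<omega> j * gE' i * gA i)),
         commutator (gN i) (gAd j) -
           (if i < j then scal \<omega> * gE' i * gAd i * gE' j * brH \<omega> j
            else if i = j then gAd i else 0)}"
    | (NN) i j where "i \<in> {1..n}" "j \<in> {1..n}" "i < j"
        "r = commutator (gN i) (gN j) - scal \<omega> * gE' i * gAd i * gE' j * gA j"
    unfolding braided_rels_def by (elim UnE UN_E CollectE exE conjE) metis+
  then show ?thesis
  proof cases
    case central
    then show ?thesis by (intro subst_central_rels) auto
  next
    case (pair i j)
    from pair(3) show ?thesis
      by (elim insertE emptyE; use rels[of i j] pair(1,2) in
          \<open>simp add: subst_simps subst_brH split: if_splits\<close>)
  next
    case (NN i j)
    then show ?thesis using rels[of i j] by (simp add: subst_simps subst_brH)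
  qed
qed

lemma unbraid_relations:
  assumes "r \<in> tensor_rels \<omega> n"
  shows "subst (unbraid \<omega> n) r \<in> relation_ideal (heis_gens n) (braided_rels \<omega> n)"
proof -
  interpret heis_relations n "braided_rels \<omega> n"
    by (rule heis_relations.intro[OF _ braided_rels_subset]) (auto simp only: braided_rels_def)
  \<comment> \<open>The roles are exchanged: \<open>B\<close>, \<open>M\<close> are now the braided
    generators, and \<open>A\<close>, \<open>N\<close> are their images under
    \<open>unbraid\<close>.\<close>
  interpret triangular_change K n "scal \<omega>" gE' "brH \<omega>" "ann_unbraid \<omega> n" gAd
    "\<lambda>i. unbraid \<omega> n (Num i)" gA gN "unbraid_tail \<omega> n"
  proof
    show "gA i = ann_unbraid \<omega> n i + scal \<omega> * gE' i * brH \<omega> i * unbraid_tail \<omega> n i" for i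
      by (subst ann_unbraid.simps) (simp add: twist_def unbraid_tail_def)
  qed (simp_all add: central_scal two_sided_ideal_axioms central_gens central_brH
        unbraid_tail_def)
  have braided_relations
    unfolding braided_relations_def eqv_def
  proof (intro ballI conjI impI)
    fix i j assume ij: "i \<in> {1..n}" "j \<in> {1..n}"
    show "commutator (gA i) (gA j) - 0 \<in> K" "commutator (gAd i) (gAd j) - 0 \<in> K"
      "commutator (gA i) (gAd j) -
         (if i < j then scal \<omega> * gE' i * brH \<omega> i * gE' j * brH \<omega> j
          else if i = j then brH \<omega> i else 0) \<in> K"
      "commutator (gN i) (gA j) -
         (if i < j then 0
          else if i = j then - gA i
          else - (scal \<omega> * gE' j * brH \<omega> j * gE' i * gA i)) \<in> K"
      "commutator (gN i) (gAd j) -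
         (if i < j then scal \<omega> * gE' i * gAd i * gE' j * brH \<omega> j
          else if i = j then gAd i else 0) \<in> K"
      by (rule relation_mem_ideal[OF braided_rels_subset],
          rule subsetD[OF equalityD2[OF braided_rels_def]],
          rule UnI1, rule UnI2, rule UN_I[OF ij(1)], rule UN_I[OF ij(2)], simp)+
    show "commutator (gN i) (gN j) - scal \<omega> * gE' i * gAd i * gE' j * gA j \<in> K" if "i < j"
      by (rule relation_mem_ideal[OF braided_rels_subset],
          rule subsetD[OF equalityD2[OF braided_rels_def]], rule UnI2)
        (use ij that in blast)
  qed
  then have tensor_relations by (rule tensor_if_braided)
  note rels = this[unfolded tensor_relations_def eqv_def, rule_format]
  from assms consider (central) "r \<in> central_rels n"
    | (pair) i j where "i \<in> {1..n}" "j \<in> {1..n}"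
        "r \<in> {commutator (gA i) (gA j),
         commutator (gAd i) (gAd j),
         commutator (gA i) (gAd j) - (if i = j then brH \<omega> i else 0),
         commutator (gN i) (gA j) - (if i = j then - gA i else 0),
         commutator (gN i) (gAd j) - (if i = j then gAd i else 0),
         commutator (gN i) (gN j)}"
    unfolding tensor_rels_def by (elim UnE UN_E) metis+
  then show ?thesis
  proof cases
    case central
    then show ?thesis by (intro subst_central_rels) auto
  next
    case (pair i j)
    from pair(3) show ?thesis
      by (elim insertE emptyE; use rels[of i j] pair(1,2) in
          \<open>simp add: subst_simps subst_brH split: if_splits\<close>)
  qed
qed

theorem theorem5p1:
  fixes \<omega> :: complex and n :: nat
  assumes "\<omega> \<noteq> 0" and "n \<ge> 1"
  shows "algebras_isomorphic (BUq_braided_tensor \<omega> n) (Uq_tensor \<omega> n)"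
  unfolding BUq_braided_tensor_def Uq_tensor_def
proof (rule presented_algebra_iso)
  \<comment> \<open>The substituted relations stay in the free algebra on
    \<open>heis_gens n\<close>, where membership in \<open>relation_ideal\<close> is membership in
    the generated ideal.\<close>
  show "subst (braid \<omega> n) ` braided_rels \<omega> n \<subseteq> Idl\<^bsub>free_algebra (heis_gens n)\<^esub> tensor_rels \<omega> n"
    using braid_relations subst_closed[OF subsetD[OF braided_rels_subset] braid_closed]
    by (auto simp flip: relation_ideal_iff)
  show "subst (unbraid \<omega> n) ` tensor_rels \<omega> n \<subseteq> Idl\<^bsub>free_algebra (heis_gens n)\<^esub> braided_rels \<omega> n"
    using unbraid_relations subst_closed[OF subsetD[OF tensor_rels_subset] unbraid_closed]
    by (auto simp flip: relation_ideal_iff)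
qed (simp_all add: braid_closed unbraid_closed braid_unbraid unbraid_braid
    tensor_rels_subset braided_rels_subset)

end
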